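(* For every integer $n\geq 3$, $I\!R_b(C_n)=\Gamma_b(C_n)$, where $C_n$ is the cycle of order $n$.
   Context: For a graph $G=(V,E)$, a broadcast is a function $f:V\to\{0,\dots,\operatorname{diam}(G)\}$ with $f(v)\le e_G(v)$ (eccentricity) for all $v$. Let $V^+_f=\{v: f(v)>0\}$ and $H_f(u)=\{v\in V^+_f: d_G(u,v)\le f(v)\}$. For $v\in V^+_f$, $PN_f(v)=\{u\in V: H_f(u)=\{v\}\}$, and $PB_f(v)$ is $\{v\}$ if $f(v)=1$ and $PN_f(v)=\{v\}$, and otherwise $PB_f(v)=\{u\in PN_f(v): d_G(u,v)=f(v)\}$. The cost is $\sigma(f)=\sum_v f(v)$. A broadcast of some type is minimal if no other broadcast $g\ne f$ of the same type satisfies $g\le f$ pointwise. $f$ is dominating if $|H_f(u)|\ge1$ for all $u\in V$; $\Gamma_b(G)$ is the maximum cost of a minimal dominating broadcast. $f$ is irredundant if $PB_f(v)\ne\emptyset$ for every $v\in V^+_f$; $I\!R_b(G)$ is the maximum cost of an irredundant broadcast. *)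

theory Defs
  imports "Graph_Theory.Graph_Theory" "HOL-Library.FuncSet"
begin

text \<open>Undirected graphs are the symmetric digraphs of the locale \<^locale>\<open>graph\<close>: every edge is
  represented by its two orientations. Distance, eccentricity and diameter below have their usual
  meaning for nonempty finite connected graphs only; the cycles are shown to be such graphs.\<close>

definition gdist :: "('a, 'b) pre_digraph \<Rightarrow> 'a \<Rightarrow> 'a \<Rightarrow> nat" where
  "gdist G u v = (LEAST k. \<exists>p. pre_digraph.awalk G u p v \<and> length p = k)"

definition ecc :: "('a, 'b) pre_digraph \<Rightarrow> 'a \<Rightarrow> nat" where
  "ecc G v = Max (gdist G v ` verts G)"

definition diam :: "('a, 'b) pre_digraph \<Rightarrow> nat" where
  "diam G = Max (ecc G ` verts G)"

text \<open>A broadcast is a function on the vertex set, i.e. extensional outside of it, so that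
  \<open>g \<noteq> f\<close> means that \<open>g\<close> and \<open>f\<close> differ at some vertex.\<close>

definition broadcast :: "('a, 'b) pre_digraph \<Rightarrow> ('a \<Rightarrow> nat) \<Rightarrow> bool" where
  "broadcast G f \<longleftrightarrow> f \<in> verts G \<rightarrow>\<^sub>E {0..diam G} \<and> (\<forall>v\<in>verts G. f v \<le> ecc G v)"

definition bc_support :: "('a, 'b) pre_digraph \<Rightarrow> ('a \<Rightarrow> nat) \<Rightarrow> 'a set" where
  "bc_support G f = {v \<in> verts G. f v > 0}"

definition bc_heard :: "('a, 'b) pre_digraph \<Rightarrow> ('a \<Rightarrow> nat) \<Rightarrow> 'a \<Rightarrow> 'a set" where
  "bc_heard G f u = {v \<in> bc_support G f. gdist G u v \<le> f v}"

definition priv_nbhd :: "('a, 'b) pre_digraph \<Rightarrow> ('a \<Rightarrow> nat) \<Rightarrow> 'a \<Rightarrow> 'a set" where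
  "priv_nbhd G f v = {u \<in> verts G. bc_heard G f u = {v}}"

definition priv_border :: "('a, 'b) pre_digraph \<Rightarrow> ('a \<Rightarrow> nat) \<Rightarrow> 'a \<Rightarrow> 'a set" where
  "priv_border G f v =
     (if f v = 1 \<and> priv_nbhd G f v = {v} then {v}
      else {u \<in> priv_nbhd G f v. gdist G u v = f v})"

definition bc_cost :: "('a, 'b) pre_digraph \<Rightarrow> ('a \<Rightarrow> nat) \<Rightarrow> nat" where
  "bc_cost G f = (\<Sum>v\<in>verts G. f v)"

definition dominating_broadcast :: "('a, 'b) pre_digraph \<Rightarrow> ('a \<Rightarrow> nat) \<Rightarrow> bool" where
  "dominating_broadcast G f \<longleftrightarrow> broadcast G f \<and> (\<forall>u\<in>verts G. card (bc_heard G f u) \<ge> 1)"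

definition irredundant_broadcast :: "('a, 'b) pre_digraph \<Rightarrow> ('a \<Rightarrow> nat) \<Rightarrow> bool" where
  "irredundant_broadcast G f \<longleftrightarrow>
     broadcast G f \<and> (\<forall>v\<in>bc_support G f. priv_border G f v \<noteq> {})"

definition minimal_broadcast ::
    "('a, 'b) pre_digraph \<Rightarrow> (('a \<Rightarrow> nat) \<Rightarrow> bool) \<Rightarrow> ('a \<Rightarrow> nat) \<Rightarrow> bool" where
  "minimal_broadcast G P f \<longleftrightarrow>
     P f \<and> \<not> (\<exists>g. P g \<and> g \<noteq> f \<and> (\<forall>v\<in>verts G. g v \<le> f v))"

definition upper_broadcast_domination :: "('a, 'b) pre_digraph \<Rightarrow> nat" (\<open>\<Gamma>\<^sub>b\<close>) where
  "\<Gamma>\<^sub>b G = Max (bc_cost G ` {f. minimal_broadcast G (dominating_broadcast G) f})"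

definition upper_broadcast_irredundance :: "('a, 'b) pre_digraph \<Rightarrow> nat" (\<open>IR\<^sub>b\<close>) where
  "IR\<^sub>b G = Max (bc_cost G ` {f. irredundant_broadcast G f})"

definition cycle_graph :: "nat \<Rightarrow> (nat, nat \<times> nat) pre_digraph" (\<open>C\<^bsub>_\<^esub>\<close>) where
  "C\<^bsub>n\<^esub> = \<lparr>verts = {0..<n},
     arcs = {(i, j). i < n \<and> j < n \<and> (j = (i + 1) mod n \<or> i = (j + 1) mod n)},
     tail = fst, head = snd\<rparr>"

lemma graph_cycle_graph:
  assumes "n \<ge> 3"
  shows "graph C\<^bsub>n\<^esub>"
proof
  have "arcs C\<^bsub>n\<^esub> \<subseteq> {0..<n} \<times> {0..<n}"
    by (auto simp: cycle_graph_def)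
  then show "finite (arcs C\<^bsub>n\<^esub>)"
    by (rule finite_subset) simp
  show "symmetric C\<^bsub>n\<^esub>"
    by (auto simp: symmetric_def sym_def arcs_ends_def arc_to_ends_def cycle_graph_def)
  show "tail C\<^bsub>n\<^esub> e \<noteq> head C\<^bsub>n\<^esub> e" if "e \<in> arcs C\<^bsub>n\<^esub>" for e
    using that assms by (auto simp: cycle_graph_def mod_Suc split: if_splits)
qed (auto simp: cycle_graph_def arc_to_ends_def)

lemma cycle_graph_reachable:
  assumes "n \<ge> 3" "u < n" "v < n"
  shows "u \<rightarrow>\<^sup>*\<^bsub>C\<^bsub>n\<^esub>\<^esub> v"
proof -
  interpret graph "C\<^bsub>n\<^esub>"
    using assms(1) by (rule graph_cycle_graph)
  have *: "0 \<rightarrow>\<^sup>*\<^bsub>C\<^bsub>n\<^esub>\<^esub> w" if "w < n" for w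
    using that
  proof (induction w)
    case 0
    then show ?case
      by (intro reachable_refl) (simp add: cycle_graph_def)
  next
    case (Suc w)
    have "(w, Suc w) \<in> arcs_ends C\<^bsub>n\<^esub>"
      using Suc.prems by (auto simp: arcs_ends_def arc_to_ends_def cycle_graph_def)
    moreover have "0 \<rightarrow>\<^sup>*\<^bsub>C\<^bsub>n\<^esub>\<^esub> w"
      using Suc by simp
    ultimately show ?case
      by (rule reachable_adj_trans[rotated])
  qed
  show ?thesis
    using symmetric_reachable'[OF *[OF assms(2)]] *[OF assms(3)] by (rule reachable_trans)
qed

lemma strongly_connected_cycle_graph:
  assumes "n \<ge> 3"
  shows "strongly_connected C\<^bsub>n\<^esub>"
  using assms cycle_graph_reachable[OF assms]
  by (intro strongly_connectedI) (auto simp: cycle_graph_def)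

lemma finite_broadcasts:
  assumes "finite (verts G)"
  shows "finite {f. broadcast G f}"
  by (rule finite_subset[of _ "verts G \<rightarrow>\<^sub>E {0..diam G}"])
    (auto simp: broadcast_def intro!: finite_PiE assms)

lemma irredundant_broadcast_zero:
  "irredundant_broadcast G (\<lambda>v\<in>verts G. 0)"
  by (auto simp: irredundant_broadcast_def broadcast_def bc_support_def)

lemma ex_minimal_dominating_broadcast:
  assumes "finite (verts G)" "dominating_broadcast G f"
  shows "\<exists>g. minimal_broadcast G (dominating_broadcast G) g"
proof -
  obtain g where g: "dominating_broadcast G g"
    and min: "\<And>h. dominating_broadcast G h \<Longrightarrow> bc_cost G g \<le> bc_cost G h"
    using ex_has_least_nat[of "dominating_broadcast G" f "bc_cost G"] assms(2) by blast
  have "h = g" if h: "dominating_broadcast G h" and le: "\<forall>v\<in>verts G. h v \<le> g v" for h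
  proof -
    have "h v = g v" if "v \<in> verts G" for v
    proof (rule ccontr)
      assume "h v \<noteq> g v"
      then have "bc_cost G h < bc_cost G g"
        unfolding bc_cost_def using le that assms(1)
        by (intro sum_strict_mono_ex1) (auto intro!: bexI[of _ v] le_neq_trans)
      then show False
        using min[OF h] by simp
    qed
    then show ?thesis
      using g h PiE_ext unfolding dominating_broadcast_def broadcast_def by blast
  qed
  then show ?thesis
    using g unfolding minimal_broadcast_def by blast
qed

lemma cycle_graph_ecc_pos:
  assumes "n \<ge> 3" "u < n"
  shows "ecc C\<^bsub>n\<^esub> u \<ge> 1"
proof -
  interpret graph "C\<^bsub>n\<^esub>"
    using assms(1) by (rule graph_cycle_graph)
  define v :: nat where "v = (if u = 0 then 1 else 0)"
  have v: "v < n" "v \<noteq> u"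
    using assms by (auto simp: v_def)
  obtain p where "awalk u p v"
    using cycle_graph_reachable[OF assms v(1)] reachable_awalk by blast
  then have "\<exists>k q. awalk u q v \<and> length q = k"
    by blast
  from LeastI_ex[OF this] have "\<exists>q. awalk u q v \<and> length q = gdist C\<^bsub>n\<^esub> u v"
    by (simp only: gdist_def)
  then have "gdist C\<^bsub>n\<^esub> u v \<noteq> 0"
    using v(2) by (metis awalk_Nil_iff length_0_conv)
  moreover have "gdist C\<^bsub>n\<^esub> u v \<le> ecc C\<^bsub>n\<^esub> u"
    unfolding ecc_def using v(1) by (intro Max_ge) (auto simp: cycle_graph_def)
  ultimately show ?thesis
    by simp
qed

lemma cycle_graph_dominating_broadcast_one:
  assumes "n \<ge> 3"
  shows "dominating_broadcast C\<^bsub>n\<^esub> (\<lambda>v\<in>verts C\<^bsub>n\<^esub>. 1)"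
proof -
  interpret graph "C\<^bsub>n\<^esub>"
    using assms by (rule graph_cycle_graph)
  let ?f = "\<lambda>v\<in>verts C\<^bsub>n\<^esub>. 1 :: nat"
  have pos: "ecc C\<^bsub>n\<^esub> v \<ge> 1" if "v \<in> verts C\<^bsub>n\<^esub>" for v
    using cycle_graph_ecc_pos[OF assms] that by (simp add: cycle_graph_def)
  have "0 \<in> verts C\<^bsub>n\<^esub>"
    using assms by (simp add: cycle_graph_def)
  then have "ecc C\<^bsub>n\<^esub> 0 \<le> diam C\<^bsub>n\<^esub>"
    unfolding diam_def by (intro Max_ge) auto
  then have "diam C\<^bsub>n\<^esub> \<ge> 1"
    using pos[OF \<open>0 \<in> verts C\<^bsub>n\<^esub>\<close>] by linarith
  then have "broadcast C\<^bsub>n\<^esub> ?f"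
    using pos by (auto simp: broadcast_def)
  moreover have "card (bc_heard C\<^bsub>n\<^esub> ?f u) \<ge> 1" if "u \<in> verts C\<^bsub>n\<^esub>" for u
  proof -
    have "gdist C\<^bsub>n\<^esub> u u \<le> 0"
      unfolding gdist_def using that by (intro Least_le) (auto simp: awalk_Nil_iff)
    then have "u \<in> bc_heard C\<^bsub>n\<^esub> ?f u"
      using that by (simp add: bc_heard_def bc_support_def)
    moreover have "finite (bc_heard C\<^bsub>n\<^esub> ?f u)"
      by (simp add: bc_heard_def bc_support_def)
    ultimately show ?thesis
      by (metis One_nat_def Suc_leI card_gt_0_iff empty_iff)
  qed
  ultimately show ?thesis
    by (simp add: dominating_broadcast_def)
qed

lemma upper_broadcast_irredundance_wf:
  assumes "finite (verts G)"
  shows "finite {f. irredundant_broadcast G f}" "{f. irredundant_broadcast G f} \<noteq> {}"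
  using finite_subset[OF _ finite_broadcasts[OF assms], of "{f. irredundant_broadcast G f}"]
    irredundant_broadcast_zero[of G]
  by (auto simp: irredundant_broadcast_def)

lemma upper_broadcast_domination_cycle_graph_wf:
  assumes "n \<ge> 3"
  shows "finite {f. minimal_broadcast C\<^bsub>n\<^esub> (dominating_broadcast C\<^bsub>n\<^esub>) f}"
    and "{f. minimal_broadcast C\<^bsub>n\<^esub> (dominating_broadcast C\<^bsub>n\<^esub>) f} \<noteq> {}"
proof -
  have fin: "finite (verts C\<^bsub>n\<^esub>)"
    by (simp add: cycle_graph_def)
  show "finite {f. minimal_broadcast C\<^bsub>n\<^esub> (dominating_broadcast C\<^bsub>n\<^esub>) f}"
    by (rule finite_subset[OF _ finite_broadcasts[OF fin]])
      (auto simp: minimal_broadcast_def dominating_broadcast_def)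
  show "{f. minimal_broadcast C\<^bsub>n\<^esub> (dominating_broadcast C\<^bsub>n\<^esub>) f} \<noteq> {}"
    using ex_minimal_dominating_broadcast[OF fin cycle_graph_dominating_broadcast_one[OF assms]]
    by blast
qed

end

theory Submission
  imports Defs
begin

text \<open>With \<open>m = n div 2\<close>, both parameters equal \<open>max m (2 * (m - 1))\<close>. A dominating broadcast is
  minimal iff it is irredundant, so it suffices to bound irredundant broadcasts from above and to
  exhibit one dominating irredundant broadcast attaining the bound: value \<open>m - 1\<close> at the two ends
  \<open>0\<close> and \<open>2 * m - 1\<close> of a path (value \<open>1\<close> at a single vertex if \<open>n = 3\<close>). For the upper bound,
  one broadcasting vertex costs at most \<open>m\<close>; if there are at least two, each misses a private
  vertex of another one, hence has value at most \<open>m - 1\<close>, which settles the case of two; and \<open>k\<close>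
  broadcasting vertices cost at most \<open>n - k\<close>, which settles \<open>k \<ge> 3\<close>.\<close>

section \<open>Minimality and irredundance in general graphs\<close>

lemma bc_heard_mono:
  assumes "\<forall>v\<in>verts G. g v \<le> f v"
  shows "bc_heard G g u \<subseteq> bc_heard G f u"
  using assms by (fastforce simp: bc_heard_def bc_support_def)

lemma bc_heard_card_ge_1_iff:
  assumes "finite (verts G)"
  shows "card (bc_heard G f u) \<ge> 1 \<longleftrightarrow> bc_heard G f u \<noteq> {}"
proof -
  have "finite (bc_heard G f u)"
    using assms by (simp add: bc_heard_def bc_support_def)
  then show ?thesis
    by (metis One_nat_def Suc_le_eq card_gt_0_iff)
qed

text \<open>If the value at \<open>v\<close> drops, a private border vertex of \<open>v\<close>
  loses the only broadcast it hears, and by \<open>bc_heard_mono\<close> nothing replaces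
  it.\<close>

lemma minimal_dominating_if_irredundant:
  assumes dom: "dominating_broadcast G f" and irr: "irredundant_broadcast G f"
  shows "minimal_broadcast G (dominating_broadcast G) f"
proof -
  have "g = f" if g: "dominating_broadcast G g" and le: "\<forall>v\<in>verts G. g v \<le> f v" for g
  proof (rule ccontr)
    assume "g \<noteq> f"
    then obtain v where v: "v \<in> verts G" "g v \<noteq> f v"
      using g dom PiE_ext unfolding dominating_broadcast_def broadcast_def by metis
    then have lt: "g v < f v"
      using le by (simp add: le_neq_trans)
    then have "priv_border G f v \<noteq> {}"
      using irr v(1) by (auto simp: irredundant_broadcast_def bc_support_def)
    \<comment> \<open>The alternative \<open>g v = 0\<close> handles the exceptional border
      \<open>{v}\<close>: there \<open>f v = 1\<close>, so any decrease silences
      \<open>v\<close>.\<close>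
    then obtain u where u: "u \<in> verts G" "bc_heard G f u = {v}" "g v = 0 \<or> gdist G u v = f v"
      using lt by (fastforce simp: priv_border_def priv_nbhd_def split: if_splits)
    have "v \<notin> bc_heard G g u"
      using u(3) lt by (auto simp: bc_heard_def bc_support_def)
    then have "bc_heard G g u = {}"
      using bc_heard_mono[OF le, of u] u(2) by auto
    then show False
      using g u(1) by (auto simp: dominating_broadcast_def)
  qed
  then show ?thesis
    using dom by (auto simp: minimal_broadcast_def)
qed

text \<open>By minimality, lowering \<open>f v\<close> by one leaves some \<open>u\<close> unheard;
  under \<open>f\<close>, this \<open>u\<close> hears exactly \<open>v\<close>.\<close>

lemma irredundant_if_minimal_dominating:
  assumes fin: "finite (verts G)"
    and dist_0: "\<And>u v. u \<in> verts G \<Longrightarrow> v \<in> verts G \<Longrightarrow> gdist G u v = 0 \<Longrightarrow> u = v"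
    and min: "minimal_broadcast G (dominating_broadcast G) f"
  shows "irredundant_broadcast G f"
proof -
  have dom: "dominating_broadcast G f"
    using min by (simp add: minimal_broadcast_def)
  have "priv_border G f v \<noteq> {}" if "v \<in> bc_support G f" for v
  proof -
    have v: "v \<in> verts G" "f v > 0"
      using that by (auto simp: bc_support_def)
    define g where "g = f(v := f v - 1)"
    have g: "broadcast G g" "g \<noteq> f" "\<forall>w\<in>verts G. g w \<le> f w"
      using dom v
      by (auto simp: g_def dominating_broadcast_def broadcast_def PiE_iff extensional_def
        fun_upd_idem_iff le_diff_conv intro: le_SucI)
    then obtain u where u: "u \<in> verts G" "bc_heard G g u = {}"
      using min bc_heard_card_ge_1_iff[OF fin, of g]
      by (auto simp: minimal_broadcast_def dominating_broadcast_def)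
    have "bc_heard G f u \<noteq> {}"
      using dom u(1) bc_heard_card_ge_1_iff[OF fin, of f] by (auto simp: dominating_broadcast_def)
    moreover have "bc_heard G f u \<subseteq> {v}"
      using u(2) by (auto simp: bc_heard_def bc_support_def g_def split: if_splits)
    ultimately have heard: "bc_heard G f u = {v}"
      by auto
    then have pn: "u \<in> priv_nbhd G f v" and d_le: "gdist G u v \<le> f v"
      using u(1) by (auto simp: priv_nbhd_def bc_heard_def)
    show ?thesis
    proof (cases "f v = 1")
      \<comment> \<open>Here \<open>v\<close> falls silent under \<open>g\<close>, so
        \<open>u\<close> may be \<open>v\<close> itself. If \<open>v\<close> is not its own only
        private neighbour, another one \<open>w\<close> exists, and \<open>dist_0\<close> forces its
        distance to be exactly 1.\<close>
      case True
      show ?thesis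
      proof (cases "priv_nbhd G f v = {v}")
        case True
        then show ?thesis
          using \<open>f v = 1\<close> by (simp add: priv_border_def)
      next
        case False
        then obtain w where w: "w \<in> priv_nbhd G f v" "w \<noteq> v"
          using pn by blast
        then have "w \<in> verts G" "v \<in> bc_heard G f w"
          by (auto simp: priv_nbhd_def)
        then have "w \<in> verts G" "gdist G w v \<le> 1"
          using \<open>f v = 1\<close> by (auto simp: bc_heard_def)
        then have "gdist G w v = f v"
          using dist_0[of w v] v(1) w(2) \<open>f v = 1\<close> by linarith
        then show ?thesis
          using False w(1) by (auto simp: priv_border_def)
      qed
    next
      case False
      then have "v \<in> bc_support G g"
        using v by (auto simp: bc_support_def g_def)
      then have "\<not> gdist G u v \<le> f v - 1"
        using u(2) by (auto simp: bc_heard_def g_def)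
      then have "gdist G u v = f v"
        using d_le by linarith
      then show ?thesis
        using False pn by (auto simp: priv_border_def)
    qed
  qed
  then show ?thesis
    using dom by (simp add: irredundant_broadcast_def dominating_broadcast_def)
qed

section \<open>Arithmetic of the cycle metric\<close>

text \<open>The length of the shorter arc; the case distinction forms the absolute difference
  despite truncated subtraction.\<close>

definition cycle_dist :: "nat \<Rightarrow> nat \<Rightarrow> nat \<Rightarrow> nat" where
  "cycle_dist n u v = (let d = (if u \<le> v then v - u else u - v) in min d (n - d))"

lemma verts_cycle_graph [simp]: "verts C\<^bsub>n\<^esub> = {0..<n}"
  by (simp add: cycle_graph_def)

lemma tail_cycle_graph [simp]: "tail C\<^bsub>n\<^esub> = fst"
  by (simp add: cycle_graph_def)

lemma head_cycle_graph [simp]: "head C\<^bsub>n\<^esub> = snd"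
  by (simp add: cycle_graph_def)

lemma cycle_dist_self [simp]: "cycle_dist n u u = 0"
  by (simp add: cycle_dist_def)

lemma cycle_dist_commute: "cycle_dist n u v = cycle_dist n v u"
  by (simp add: cycle_dist_def Let_def)

lemma cycle_dist_add:
  assumes "u + d < n"
  shows "cycle_dist n u (u + d) = min d (n - d)"
  by (simp add: cycle_dist_def)

text \<open>Reduces distance bounds to linear arithmetic. The last two disjuncts describe arcs that
  wrap around between \<open>n - 1\<close> and \<open>0\<close>.\<close>

lemma cycle_dist_le_iff:
  assumes "u < n" "v < n"
  shows "cycle_dist n u v \<le> k \<longleftrightarrow> v \<le> u + k \<and> u \<le> v + k \<or> v + n \<le> u + k \<or> u + n \<le> v + k"
  using assms
proof (induction u v rule: linorder_wlog)
  case (le u v)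
  then obtain d where "v = u + d"
    using le_Suc_ex by blast
  then show ?case
    using le cycle_dist_add[of u d n] by (auto simp: min_le_iff_disj)
next
  case (sym u v)
  then show ?case
    by (auto simp: cycle_dist_commute[of n v u])
qed

text \<open>The four equations give an arc of length \<open>d\<close> in either direction, wrapping
  or not; \<open>2 * d \<le> n\<close> makes it a shortest one.\<close>

lemma cycle_dist_eq_iff:
  assumes "u < n" "v < n"
  shows "cycle_dist n u v = d \<longleftrightarrow>
    2 * d \<le> n \<and> (v = u + d \<or> u = v + d \<or> v + n = u + d \<or> u + n = v + d)"
  using assms
proof (induction u v rule: linorder_wlog)
  case (le u v)
  then obtain e where "v = u + e"
    using le_Suc_ex by blast
  then show ?case
    using le cycle_dist_add[of u e n] by (simp add: min_def; linarith)
next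
  case (sym u v)
  then show ?case
    by (auto simp: cycle_dist_commute[of n v u])
qed

lemma cycle_dist_eq_0:
  assumes "u < n" "v < n" "cycle_dist n u v = 0"
  shows "u = v"
  using assms by (auto simp: cycle_dist_eq_iff)

lemma cycle_dist_triangle:
  assumes "u < n" "v < n" "w < n"
  shows "cycle_dist n u w \<le> cycle_dist n u v + cycle_dist n v w"
  using cycle_dist_eq_iff[of u n v "cycle_dist n u v"] cycle_dist_eq_iff[of v n w "cycle_dist n v w"]
   assms unfolding cycle_dist_le_iff[OF assms(1,3)] by auto

lemma cycle_dist_le_half: "u < n \<Longrightarrow> v < n \<Longrightarrow> cycle_dist n u v \<le> n div 2"
  using cycle_dist_eq_iff[of u n v "cycle_dist n u v"] by auto

lemma cycle_dist_eq_1_iff: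
  assumes "n \<ge> 3" "u < n" "v < n"
  shows "cycle_dist n u v = 1 \<longleftrightarrow> v = (u + 1) mod n \<or> u = (v + 1) mod n"
  using assms by (auto simp: cycle_dist_eq_iff mod_Suc)

lemma ex_cycle_dist_half:
  assumes "u < n"
  shows "\<exists>v<n. cycle_dist n u v = n div 2"
proof (cases "u + n div 2 < n")
  case True
  then show ?thesis
    by (intro exI[of _ "u + n div 2"]) (auto simp: cycle_dist_eq_iff)
next
  case False
  then show ?thesis
    using assms by (intro exI[of _ "u - n div 2"]) (auto simp: cycle_dist_eq_iff)
qed

text \<open>For \<open>k = 1\<close> this provides the first step of a shortest walk.\<close>

lemma ex_between_cycle_dist:
  assumes "u < n" "v < n" "k \<le> cycle_dist n u v"
  shows "\<exists>w<n. cycle_dist n u w = k \<and> cycle_dist n w v = cycle_dist n u v - k"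
proof -
  obtain l where l: "cycle_dist n u v = k + l"
    using assms(3) le_Suc_ex by blast
  then have *: "2 * (k + l) \<le> n"
    "v = u + (k + l) \<or> u = v + (k + l) \<or> v + n = u + (k + l) \<or> u + n = v + (k + l)"
    using cycle_dist_eq_iff[of u n v "k + l"] assms by auto
  \<comment> \<open>Any \<open>w\<close> at offset \<open>k\<close> from \<open>u\<close> and
    \<open>l\<close> from \<open>v\<close> will do: both offsets are at most \<open>n / 2\<close>,
    hence are distances. The cases below only keep \<open>w\<close> in range.\<close>
  have w: ?thesis if "w < n" "w = u + k \<or> u = w + k \<or> w + n = u + k \<or> u + n = w + k"
    "v = w + l \<or> w = v + l \<or> v + n = w + l \<or> w + n = v + l" for w
  proof -
    have "cycle_dist n u w = k" "cycle_dist n w v = l"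
      using that *(1) assms(1,2) by (simp_all add: cycle_dist_eq_iff)
    then show ?thesis
      using that(1) l by (intro exI[of _ w]) simp
  qed
  show ?thesis
    using *(2)
  proof (elim disjE)
    assume "v = u + (k + l)"
    then show ?thesis
      using assms by (intro w[of "u + k"]) auto
  next
    assume "u = v + (k + l)"
    then show ?thesis
      using assms by (intro w[of "v + l"]) auto
  next
    assume "v + n = u + (k + l)"
    then show ?thesis
      using assms by (cases "u + k < n"; intro w[of "(u + k) mod n"]) (auto simp: mod_if)
  next
    assume "u + n = v + (k + l)"
    then show ?thesis
      using assms by (cases "v + l < n"; intro w[of "(v + l) mod n"]) (auto simp: mod_if)
  qed
qed

section \<open>Distance, eccentricity and diameter of the cycle\<close>

text \<open>By the triangle inequality each arc of a walk reduces \<open>cycle_dist\<close> to the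
  target by at most one; conversely, a neighbour one closer always exists, which yields a walk of
  that length.\<close>

lemma gdist_cycle_graph:
  assumes n: "n \<ge> 3" and u: "u < n" and v: "v < n"
  shows "gdist C\<^bsub>n\<^esub> u v = cycle_dist n u v"
proof -
  interpret graph "C\<^bsub>n\<^esub>"
    using n by (rule graph_cycle_graph)
  have lower: "cycle_dist n x v \<le> length p" if "awalk x p v" for x p
    using that
  proof (induction p arbitrary: x)
    case Nil
    then show ?case
      by (simp add: awalk_Nil_iff)
  next
    case (Cons e p)
    then have e: "e \<in> arcs C\<^bsub>n\<^esub>" "x = fst e" and tl: "awalk (snd e) p v"
      by (auto simp: awalk_Cons_iff)
    have "x < n" "snd e < n" "cycle_dist n x (snd e) = 1"
      using e cycle_dist_eq_1_iff[OF n, of x "snd e"] by (auto simp: cycle_graph_def)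
    then show ?case
      using Cons.IH[OF tl] cycle_dist_triangle[of x n "snd e" v] v by simp
  qed
  have upper: "\<exists>p. awalk x p v \<and> length p = k" if "x < n" "cycle_dist n x v = k" for x k
    using that
  proof (induction k arbitrary: x)
    case 0
    then show ?case
      using cycle_dist_eq_0[of x n v] v by (intro exI[of _ "[]"]) (simp add: awalk_Nil_iff)
  next
    case (Suc k)
    then obtain y where y: "y < n" "cycle_dist n x y = 1" "cycle_dist n y v = k"
      using ex_between_cycle_dist[of x n v 1] v by auto
    then obtain p where p: "awalk y p v" "length p = k"
      using Suc.IH by blast
    have "(x, y) \<in> arcs C\<^bsub>n\<^esub>"
      using y cycle_dist_eq_1_iff[OF n Suc.prems(1) y(1)] Suc.prems(1) by (simp add: cycle_graph_def)
    then have "awalk x ((x, y) # p) v"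
      using p(1) by (simp add: awalk_Cons_iff)
    then show ?case
      using p(2) by (metis length_Cons)
  qed
  show ?thesis
    unfolding gdist_def by (rule Least_equality) (use upper[OF u refl] lower in blast)+
qed

lemma ecc_cycle_graph:
  assumes "n \<ge> 3" "u < n"
  shows "ecc C\<^bsub>n\<^esub> u = n div 2"
proof -
  have "gdist C\<^bsub>n\<^esub> u ` verts C\<^bsub>n\<^esub> = cycle_dist n u ` {0..<n}"
    using assms by (intro image_cong) (auto simp: gdist_cycle_graph)
  moreover have "Max (cycle_dist n u ` {0..<n}) = n div 2"
    using ex_cycle_dist_half[OF assms(2)] cycle_dist_le_half[OF assms(2)] by (intro Max_eqI) force+
  ultimately show ?thesis
    by (simp add: ecc_def)
qed

lemma diam_cycle_graph:
  assumes "n \<ge> 3"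
  shows "diam C\<^bsub>n\<^esub> = n div 2"
proof -
  have "ecc C\<^bsub>n\<^esub> ` verts C\<^bsub>n\<^esub> = {n div 2}"
    using assms by (auto simp: ecc_cycle_graph image_iff intro!: exI[of _ 0])
  then show ?thesis
    by (simp add: diam_def)
qed

section \<open>Irredundant broadcasts on the cycle: upper bound\<close>

text \<open>All eccentricities equal the diameter, so the range condition alone remains.\<close>

lemma broadcast_cycle_graph_iff:
  assumes "n \<ge> 3"
  shows "broadcast C\<^bsub>n\<^esub> f \<longleftrightarrow> f \<in> {0..<n} \<rightarrow>\<^sub>E {0..n div 2}"
  using assms by (auto simp: broadcast_def diam_cycle_graph ecc_cycle_graph)

lemma bc_heard_cycle_graph:
  assumes "n \<ge> 3" "u < n"
  shows "bc_heard C\<^bsub>n\<^esub> f u = {v. v < n \<and> f v > 0 \<and> cycle_dist n u v \<le> f v}"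
  using assms by (auto simp: bc_heard_def bc_support_def gdist_cycle_graph)

lemma cycle_graph_unheard:
  assumes "n \<ge> 3" "bc_heard C\<^bsub>n\<^esub> f u = {v}" "u < n" "w \<in> bc_support C\<^bsub>n\<^esub> f" "w \<noteq> v"
  shows "f w < cycle_dist n u w"
proof (rule ccontr)
  assume "\<not> ?thesis"
  then have "w \<in> bc_heard C\<^bsub>n\<^esub> f u"
    using assms(1,3-5) by (simp add: bc_heard_def gdist_cycle_graph bc_support_def)
  then show False
    using assms by simp
qed

text \<open>Restates the two clauses of \<open>priv_border\<close> metrically; either way some
  vertex hears only \<open>v\<close>.\<close>

lemma cycle_graph_private_cases:
  assumes n: "n \<ge> 3" and irr: "irredundant_broadcast C\<^bsub>n\<^esub> f" and v: "v < n" "f v > 0"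
  obtains (border) u where "u < n" "bc_heard C\<^bsub>n\<^esub> f u = {v}" "cycle_dist n v u = f v"
  | (self) "f v = 1" "bc_heard C\<^bsub>n\<^esub> f v = {v}"
proof -
  obtain u where "u \<in> priv_border C\<^bsub>n\<^esub> f v"
    using irr v by (auto simp: irredundant_broadcast_def bc_support_def)
  then consider "f v = 1" "bc_heard C\<^bsub>n\<^esub> f v = {v}"
    | "u < n" "bc_heard C\<^bsub>n\<^esub> f u = {v}" "gdist C\<^bsub>n\<^esub> u v = f v"
    by (auto simp: priv_border_def priv_nbhd_def split: if_splits)
  then show ?thesis
  proof cases
    case 1
    then show ?thesis
      by (rule self)
  next
    case 2
    then have "cycle_dist n v u = f v"
      using n v(1) gdist_cycle_graph[of n u v] cycle_dist_commute[of n v u] by simp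
    with 2(1,2) show ?thesis
      by (rule border)
  qed
qed

text \<open>A shortest path from \<open>v\<close> to a private border vertex \<open>u\<close> has \<open>f v + 1\<close> vertices. Two such
  paths cannot share a vertex \<open>w\<close>: since \<open>u\<close> does not hear \<open>v'\<close>, the triangle inequality through
  \<open>w\<close> makes \<open>u\<close> farther from \<open>w\<close> than \<open>u'\<close>, and symmetrically. If \<open>v\<close> is only private to itself,
  the path is replaced by the edge to its successor.\<close>

lemma irredundant_cycle_graph_cost_plus_card:
  assumes n: "n \<ge> 3" and irr: "irredundant_broadcast C\<^bsub>n\<^esub> f"
  shows "bc_cost C\<^bsub>n\<^esub> f + card (bc_support C\<^bsub>n\<^esub> f) \<le> n"
proof -
  let ?S = "bc_support C\<^bsub>n\<^esub> f"
  define P where "P v u \<longleftrightarrow> u < n \<and> bc_heard C\<^bsub>n\<^esub> f u = {v} \<and> cycle_dist n v u = f v" for v u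
  define b where "b v = (SOME u. P v u)" for v
  define B where "B = {v \<in> ?S. \<exists>u. P v u}"
  \<comment> \<open>For \<open>v\<close> in \<open>B\<close> this is the union of all shortest paths
    to \<open>b v\<close>, so no path has to be chosen.\<close>
  define seg where "seg v = (if v \<in> B
      then {w. w < n \<and> cycle_dist n v w + cycle_dist n w (b v) = f v} else {v, (v + 1) mod n})" for v
  have S: "v < n" "f v > 0" if "v \<in> ?S" for v
    using that by (auto simp: bc_support_def)
  have b: "b v < n" "bc_heard C\<^bsub>n\<^esub> f (b v) = {v}" "cycle_dist n v (b v) = f v" if "v \<in> B" for v
    using that someI_ex[of "P v"] by (auto simp: B_def b_def P_def)
  note far = cycle_graph_unheard[OF n, where f = f]
  have self: "f v = 1" "bc_heard C\<^bsub>n\<^esub> f v = {v}" if "v \<in> ?S" "v \<notin> B" for v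
    by (rule cycle_graph_private_cases[OF n irr S[OF that(1)]]; use that in \<open>auto simp: B_def P_def\<close>)+
  have succ: "(v + 1) mod n < n" "cycle_dist n v ((v + 1) mod n) = 1" if "v < n" for v
    using that n cycle_dist_eq_1_iff[of n v "(v + 1) mod n"] by auto
  have sub: "seg v \<subseteq> {0..<n}" if "v \<in> ?S" for v
    using S(1)[OF that] succ(1) n by (auto simp: seg_def)
  have card_seg: "f v + 1 \<le> card (seg v)" if vS: "v \<in> ?S" for v
  proof (cases "v \<in> B")
    case True
    \<comment> \<open>Every distance from \<open>0\<close> to \<open>f v\<close> occurs on
      \<open>seg v\<close>, which gives \<open>f v + 1\<close> vertices.\<close>
    have "{0..f v} \<subseteq> cycle_dist n v ` seg v"
    proof
      fix k assume "k \<in> {0..f v}"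
      then obtain w where "w < n" "cycle_dist n v w = k" "cycle_dist n w (b v) = f v - k"
        using ex_between_cycle_dist[OF S(1)[OF vS] b(1)[OF True], of k] b(3)[OF True] by auto
      then show "k \<in> cycle_dist n v ` seg v"
        using True \<open>k \<in> {0..f v}\<close> by (auto simp: seg_def)
    qed
    then have "card {0..f v} \<le> card (seg v)"
      using finite_subset[OF sub[OF vS]] by (intro surj_card_le) auto
    then show ?thesis
      by simp
  next
    case False
    have "v \<noteq> (v + 1) mod n"
      using succ(2)[OF S(1)[OF vS]] by auto
    then show ?thesis
      using False self(1)[OF vS False] by (simp add: seg_def)
  qed
  have BB: "seg v \<inter> seg w = {}" if "v \<in> B" "w \<in> B" "v \<noteq> w" for v w
  proof -
    have "v \<in> ?S" "w \<in> ?S"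
      using that by (auto simp: B_def)
    have False if x: "x < n" "cycle_dist n v x + cycle_dist n x (b v) = f v"
      "cycle_dist n w x + cycle_dist n x (b w) = f w" for x
      using far[OF b(2)[OF \<open>v \<in> B\<close>] b(1)[OF \<open>v \<in> B\<close>] \<open>w \<in> ?S\<close>]
        far[OF b(2)[OF \<open>w \<in> B\<close>] b(1)[OF \<open>w \<in> B\<close>] \<open>v \<in> ?S\<close>] \<open>v \<noteq> w\<close>
        cycle_dist_triangle[OF S(1)[OF \<open>w \<in> ?S\<close>] x(1) b(1)[OF \<open>v \<in> B\<close>]]
        cycle_dist_triangle[OF S(1)[OF \<open>v \<in> ?S\<close>] x(1) b(1)[OF \<open>w \<in> B\<close>]]
        cycle_dist_commute[of n w "b v"] cycle_dist_commute[of n v "b w"] x(2,3)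
      by linarith
    then show ?thesis
      using that by (auto simp: seg_def)
  qed
  have BN: "seg v \<inter> seg w = {}" if "v \<in> B" "w \<in> ?S" "w \<notin> B" for v w
  proof -
    have "v \<in> ?S" "v \<noteq> w"
      using that by (auto simp: B_def)
    have w: "w < n"
      using S(1)[OF that(2)] .
    have d: "cycle_dist n w v > f v"
      using far[OF self(2)[OF that(2,3)] w \<open>v \<in> ?S\<close> \<open>v \<noteq> w\<close>] .
    have d': "cycle_dist n (b v) w > 1"
      using far[OF b(2)[OF that(1)] b(1)[OF that(1)] that(2)] \<open>v \<noteq> w\<close> self(1)[OF that(2,3)] by auto
    have "w \<notin> seg v"
      using d that(1) cycle_dist_commute[of n v w] by (auto simp: seg_def)
    \<comment> \<open>Since \<open>w\<close> is farther than \<open>f v\<close> from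
      \<open>v\<close>, its successor could only be the end \<open>b v\<close>; but
      \<open>b v\<close> does not hear \<open>w\<close>, so it is not adjacent to
      \<open>w\<close>.\<close>
    moreover have "(w + 1) mod n \<notin> seg v"
    proof
      let ?y = "(w + 1) mod n"
      assume "?y \<in> seg v"
      then have y: "cycle_dist n v ?y + cycle_dist n ?y (b v) = f v"
        using that(1) by (simp add: seg_def)
      have "cycle_dist n w v \<le> 1 + cycle_dist n v ?y"
        using cycle_dist_triangle[OF w succ(1)[OF w] S(1)[OF \<open>v \<in> ?S\<close>]] succ(2)[OF w]
        by (simp add: cycle_dist_commute)
      then have "cycle_dist n ?y (b v) = 0"
        using y d by linarith
      then have "b v = ?y"
        using cycle_dist_eq_0 succ(1)[OF w] b(1)[OF that(1)] by metis
      then show False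
        using d' succ(2)[OF w] by (simp add: cycle_dist_commute)
    qed
    ultimately show ?thesis
      using that(3) by (auto simp: seg_def[of w])
  qed
  have NN: "seg v \<inter> seg w = {}" if "v \<in> ?S" "v \<notin> B" "w \<in> ?S" "w \<notin> B" "v \<noteq> w" for v w
  proof -
    have vw: "v < n" "w < n"
      using S(1) that by auto
    have "cycle_dist n w v > 1"
      using far[OF self(2)[OF that(3,4)] vw(2) that(1,5)] self(1)[OF that(1,2)] by simp
    then have "v \<noteq> (w + 1) mod n" "w \<noteq> (v + 1) mod n"
      using cycle_dist_eq_1_iff[OF n vw(2,1)] by auto
    moreover have "(v + 1) mod n \<noteq> (w + 1) mod n"
      using vw \<open>v \<noteq> w\<close> by (auto simp: mod_Suc split: if_splits)
    ultimately show ?thesis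
      using that by (auto simp: seg_def)
  qed
  have disj: "seg v \<inter> seg w = {}" if "v \<in> ?S" "w \<in> ?S" "v \<noteq> w" for v w
    using BB[of v w] BN[of v w] BN[of w v] NN[of v w] that by blast
  have finS: "finite ?S"
    by (simp add: bc_support_def)
  have "bc_cost C\<^bsub>n\<^esub> f = (\<Sum>v\<in>?S. f v)"
    unfolding bc_cost_def by (rule sum.mono_neutral_right) (auto simp: bc_support_def)
  then have "bc_cost C\<^bsub>n\<^esub> f + card ?S = (\<Sum>v\<in>?S. f v + 1)"
    by (simp only: sum.distrib card_eq_sum)
  also have "\<dots> \<le> (\<Sum>v\<in>?S. card (seg v))"
    using card_seg by (rule sum_mono)
  also have "\<dots> = card (\<Union>v\<in>?S. seg v)"
    using finS disj finite_subset[OF sub] by (intro card_UN_disjoint[symmetric]) auto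
  also have "\<dots> \<le> card {0..<n}"
    using sub by (intro card_mono) auto
  finally show ?thesis
    by simp
qed

lemma irredundant_cycle_graph_cost_le:
  assumes n: "n \<ge> 3" and irr: "irredundant_broadcast C\<^bsub>n\<^esub> f"
  shows "bc_cost C\<^bsub>n\<^esub> f \<le> max (n div 2) (2 * (n div 2 - 1))"
proof -
  let ?S = "bc_support C\<^bsub>n\<^esub> f"
  have finS: "finite ?S"
    by (simp add: bc_support_def)
  have S: "v < n" "f v > 0" if "v \<in> ?S" for v
    using that by (auto simp: bc_support_def)
  have cost: "bc_cost C\<^bsub>n\<^esub> f = (\<Sum>v\<in>?S. f v)"
    unfolding bc_cost_def by (rule sum.mono_neutral_right) (auto simp: bc_support_def)
  have le_half: "f v \<le> n div 2" if "v \<in> ?S" for v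
    using irr S(1)[OF that] by (auto simp: irredundant_broadcast_def broadcast_cycle_graph_iff[OF n])
  have less_half: "f v < n div 2" if vw: "v \<in> ?S" "w \<in> ?S" "v \<noteq> w" for v w
  proof -
    obtain u where u: "u < n" "bc_heard C\<^bsub>n\<^esub> f u = {w}"
      by (rule cycle_graph_private_cases[OF n irr S[OF vw(2)]]) (use S(1)[OF vw(2)] in auto)
    then have "f v < cycle_dist n u v"
      using cycle_graph_unheard[OF n u(2,1) vw(1,3)] by simp
    then show ?thesis
      using cycle_dist_le_half[OF u(1) S(1)[OF vw(1)]] by linarith
  qed
  consider "card ?S = 0" | "card ?S = 1" | "card ?S = 2" | "card ?S \<ge> 3"
    by linarith
  then show ?thesis
  proof cases
    case 1
    then show ?thesis
      using cost finS by simp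
  next
    case 2
    then obtain v where "?S = {v}"
      by (auto simp: card_1_singleton_iff)
    then show ?thesis
      using cost le_half[of v] by simp
  next
    case 3
    then obtain v w where "?S = {v, w}" "v \<noteq> w"
      by (auto simp: card_2_iff)
    then show ?thesis
      using cost less_half[of v w] less_half[of w v] by simp
  next
    \<comment> \<open>The cost is at most \<open>n - 3\<close>, and
      \<open>n \<le> 2 * (n div 2) + 1\<close>.\<close>
    case 4
    then show ?thesis
      using irredundant_cycle_graph_cost_plus_card[OF n irr] by linarith
  qed
qed

section \<open>An extremal broadcast\<close>

lemma ex_minimal_dominating_cycle_graph:
  assumes n: "n \<ge> 3"
  shows "\<exists>f. minimal_broadcast C\<^bsub>n\<^esub> (dominating_broadcast C\<^bsub>n\<^esub>) f \<and>
    bc_cost C\<^bsub>n\<^esub> f = max (n div 2) (2 * (n div 2 - 1))"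
proof -
  define m where "m = n div 2"
  \<comment> \<open>For \<open>n = 3\<close> the value \<open>m - 1\<close> would be 0. This is also
    the only case in which \<open>m\<close> exceeds \<open>2 * (m - 1)\<close>.\<close>
  define c where "c = (if n = 3 then 1 else m - 1)"
  define S where "S = (if n = 3 then {0} else {0, 2 * m - 1})"
  define f where "f = (\<lambda>v\<in>{0..<n}. if v \<in> S then c else 0)"
  have m: "2 * m \<le> n" "n \<le> 2 * m + 1"
    by (auto simp: m_def)
  have c: "c > 0" "c \<le> m"
    using n m by (auto simp: c_def)
  have S_sub: "S \<subseteq> {0..<n}"
    using n m by (auto simp: S_def)
  have heard: "bc_heard C\<^bsub>n\<^esub> f u = {v \<in> S. cycle_dist n u v \<le> c}" if "u < n" for u
  proof -
    have "w < n \<and> f w > 0 \<longleftrightarrow> w \<in> S" "w \<in> S \<Longrightarrow> f w = c" for w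
      using S_sub c(1) by (auto simp: f_def)
    then show ?thesis
      unfolding bc_heard_cycle_graph[OF n that] by auto
  qed
  have "broadcast C\<^bsub>n\<^esub> f"
    using c(2) by (auto simp: broadcast_cycle_graph_iff[OF n] f_def m_def)
  moreover have "bc_heard C\<^bsub>n\<^esub> f u \<noteq> {}" if "u < n" for u
  proof -
    \<comment> \<open>For \<open>n > 3\<close> the end \<open>0\<close> reaches \<open>0\<close> to
      \<open>m - 1\<close> and the other end reaches \<open>m\<close> to \<open>2 * m - 1\<close>;
      if \<open>n\<close> is odd, the remaining vertex \<open>2 * m\<close> is adjacent to both
      ends.\<close>
    have "\<exists>v\<in>S. cycle_dist n u v \<le> c"
      using n m that by (auto simp: S_def c_def cycle_dist_le_iff)
    then show ?thesis
      using heard[OF that] by auto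
  qed
  ultimately have dom: "dominating_broadcast C\<^bsub>n\<^esub> f"
    using bc_heard_card_ge_1_iff[of "C\<^bsub>n\<^esub>" f] by (simp add: dominating_broadcast_def)
  have "priv_border C\<^bsub>n\<^esub> f v \<noteq> {}" if "v \<in> bc_support C\<^bsub>n\<^esub> f" for v
  proof -
    have v: "v < n" "v \<in> S" "f v = c"
      using that by (auto simp: bc_support_def f_def split: if_splits)
    \<comment> \<open>For \<open>n > 3\<close> the private border vertices are the two middle
      vertices of the path, at distance \<open>m - 1\<close> from their own end and \<open>m\<close>
      from the other.\<close>
    define u where "u = (if n = 3 then 1 else if v = 0 then m - 1 else m)"
    have u: "u < n"
      using n m by (auto simp: u_def)
    have "cycle_dist n u v = c"
      using n m v(1,2) u by (auto simp: S_def c_def u_def cycle_dist_eq_iff split: if_splits)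
    moreover have "\<not> cycle_dist n u w \<le> c" if "w \<in> S" "w \<noteq> v" for w
      using n m v(1,2) u that S_sub
      by (auto simp: S_def c_def u_def cycle_dist_le_iff split: if_splits)
    ultimately have "bc_heard C\<^bsub>n\<^esub> f u = {v}" "gdist C\<^bsub>n\<^esub> u v = f v"
      using heard[OF u] v gdist_cycle_graph[OF n u v(1)] by auto
    then show ?thesis
      using u by (auto simp: priv_border_def priv_nbhd_def)
  qed
  then have "irredundant_broadcast C\<^bsub>n\<^esub> f"
    using dom by (simp add: irredundant_broadcast_def dominating_broadcast_def)
  then have "minimal_broadcast C\<^bsub>n\<^esub> (dominating_broadcast C\<^bsub>n\<^esub>) f"
    using dom by (intro minimal_dominating_if_irredundant)
  moreover have "bc_cost C\<^bsub>n\<^esub> f = max (n div 2) (2 * (n div 2 - 1))"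
  proof -
    have "bc_cost C\<^bsub>n\<^esub> f = (\<Sum>v\<in>S. c)"
      unfolding bc_cost_def f_def using S_sub
      by (intro sum.mono_neutral_cong_right) auto
    also have "\<dots> = max m (2 * (m - 1))"
      using n m by (auto simp: S_def c_def)
    finally show ?thesis
      by (simp add: m_def)
  qed
  ultimately show ?thesis
    by blast
qed

theorem theorem3p3:
  fixes n :: nat
  assumes "n \<ge> 3"
  shows "IR\<^sub>b C\<^bsub>n\<^esub> = \<Gamma>\<^sub>b C\<^bsub>n\<^esub>"
proof -
  let ?N = "max (n div 2) (2 * (n div 2 - 1))"
  let ?irr = "{f. irredundant_broadcast C\<^bsub>n\<^esub> f}"
  let ?min = "{f. minimal_broadcast C\<^bsub>n\<^esub> (dominating_broadcast C\<^bsub>n\<^esub>) f}"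
  \<comment> \<open>This inclusion transfers the upper bound to minimal dominating broadcasts and
    lets the single \<open>f\<close> below attain both maxima.\<close>
  have sub: "?min \<subseteq> ?irr"
    using assms
    by (auto intro!: irredundant_if_minimal_dominating simp: gdist_cycle_graph dest: cycle_dist_eq_0)
  have le: "bc_cost C\<^bsub>n\<^esub> f \<le> ?N" if "f \<in> ?irr" for f
    using irredundant_cycle_graph_cost_le[OF assms] that by simp
  obtain f where f: "f \<in> ?min" "bc_cost C\<^bsub>n\<^esub> f = ?N"
    using ex_minimal_dominating_cycle_graph[OF assms] by blast
  have fin: "finite ?irr"
    by (rule upper_broadcast_irredundance_wf) simp
  have "IR\<^sub>b C\<^bsub>n\<^esub> = ?N"
    unfolding upper_broadcast_irredundance_def
    using f sub le fin by (intro Max_eqI) (auto intro!: rev_image_eqI[of f])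
  moreover have "\<Gamma>\<^sub>b C\<^bsub>n\<^esub> = ?N"
    unfolding upper_broadcast_domination_def
    using f sub le finite_subset[OF sub fin] by (intro Max_eqI) (auto intro!: rev_image_eqI[of f])
  ultimately show ?thesis
    by simp
qed

end
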